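(* Let $G$ be a nonempty groupoid, let $\mathfrak{T}$ be a group with unit element $E$, and let $(S,T,P)$ be a triple of maps $S,T,P:G\to\mathfrak{T}$ (values written $S_g,T_g,P_g$) such that: (1) for all $g\in G$, $S_gT_gP_g=E$; (2) for all $g\in G$ there exists $\overline{g}\in G$ such that $S_{\overline{g}}=S_g^{-1}$ and $T_{\overline{g}}=T_g^{-1}$; (3) for all $g,h\in G$ the following relations hold in $\mathfrak{T}$: $$S_{\overline{g}h}=P_gS_hT_g,\quad T_{\overline{g}h}=S_gT_hP_g,\quad P_{\overline{g}h}=T_gP_hS_g,$$ $$S_{h\overline{g}}=T_gS_hP_g,\quad T_{h\overline{g}}=P_gT_hS_g,\quad P_{h\overline{g}}=S_gP_hT_g;$$ (4) for all $g,h\in G$, if $S_g=S_h$ and $T_g=T_h$, then $g=h$. Then $G$ is a Moufang loop. Its unit element is $e:=g\overline{g}=\overline{g}g$, which does not depend on the choice of $g\in G$, and the inverse element of $g$ is $g^{-1}=\overline{g}$.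
   Context: A groupoid is a set with a binary operation (denoted by juxtaposition). A Moufang loop is a groupoid $G$ such that: (1) in the equation $gh=k$, the knowledge of any two of $g,h,k\in G$ specifies the third one uniquely; (2) there is a distinguished element $e\in G$ (the unit element) with $eg=ge=g$ for all $g\in G$; (3) the Moufang identity $(gh)(kg)=g(hk)g$ holds for all $g,h,k\in G$ (the product $g(hk)g$ is unambiguous because $(gx)g=g(xg)$ in such a structure). The element $\overline{g}$ in hypothesis (2) is uniquely determined by $g$ because of hypothesis (4); the symbol $\overline{g}$ in hypothesis (3) refers to this element. *)

theory Defs
  imports "HOL-Algebra.Group"
begin

locale groupoid =
  fixes G :: "'a set" and mul :: "'a \<Rightarrow> 'a \<Rightarrow> 'a" (infixl "\<cdot>" 70)
  assumes closed: "\<And>g h. g \<in> G \<Longrightarrow> h \<in> G \<Longrightarrow> g \<cdot> h \<in> G"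

definition unit_element :: "'a set \<Rightarrow> ('a \<Rightarrow> 'a \<Rightarrow> 'a) \<Rightarrow> 'a \<Rightarrow> bool" where
  "unit_element G mul e \<longleftrightarrow> e \<in> G \<and> (\<forall>g\<in>G. mul e g = g \<and> mul g e = g)"

definition inverse_element :: "'a set \<Rightarrow> ('a \<Rightarrow> 'a \<Rightarrow> 'a) \<Rightarrow> 'a \<Rightarrow> 'a \<Rightarrow> 'a \<Rightarrow> bool" where
  "inverse_element G mul e g x \<longleftrightarrow> x \<in> G \<and> mul g x = e \<and> mul x g = e"

(* In gh = k, that g and h determine k is closedness of the groupoid. The product g(hk)g in the
   Moufang identity is bracketed to the left; the law flexible below shows that this
   choice is immaterial. *)
locale moufang_loop = groupoid +
  assumes left_division: "\<And>g k. g \<in> G \<Longrightarrow> k \<in> G \<Longrightarrow> \<exists>!h. h \<in> G \<and> g \<cdot> h = k"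
    and right_division: "\<And>h k. h \<in> G \<Longrightarrow> k \<in> G \<Longrightarrow> \<exists>!g. g \<in> G \<and> g \<cdot> h = k"
    and has_unit: "\<exists>e. unit_element G (\<cdot>) e"
    and moufang: "\<And>g h k. g \<in> G \<Longrightarrow> h \<in> G \<Longrightarrow> k \<in> G \<Longrightarrow>
                    (g \<cdot> h) \<cdot> (k \<cdot> g) = (g \<cdot> (h \<cdot> k)) \<cdot> g"
begin

lemma flexible:
  assumes "g \<in> G" "x \<in> G"
  shows "(g \<cdot> x) \<cdot> g = g \<cdot> (x \<cdot> g)"
proof -
  obtain e where "unit_element G (\<cdot>) e"
    using has_unit by blast
  then show ?thesis
    using moufang[of g e x] assms by (simp add: unit_element_def)
qed

end

(* The element written as g with an overline, i.e. the x in G with S x = inv (S g) and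
   T x = inv (T g). It is meaningful only where such an x exists and (S, T) separates the
   points of G; see bar_unique. *)
definition bar ::
  "'a set \<Rightarrow> ('b, 'c) monoid_scheme \<Rightarrow> ('a \<Rightarrow> 'b) \<Rightarrow> ('a \<Rightarrow> 'b) \<Rightarrow> 'a \<Rightarrow> 'a" where
  "bar G \<TT> S T g = (THE x. x \<in> G \<and> S x = inv\<^bsub>\<TT>\<^esub> (S g) \<and> T x = inv\<^bsub>\<TT>\<^esub> (T g))"

lemma bar_unique:
  assumes "\<And>g h. g \<in> G \<Longrightarrow> h \<in> G \<Longrightarrow> S g = S h \<Longrightarrow> T g = T h \<Longrightarrow> g = h"
    and "x \<in> G" "S x = inv\<^bsub>\<TT>\<^esub> (S g)" "T x = inv\<^bsub>\<TT>\<^esub> (T g)"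
  shows "bar G \<TT> S T g = x"
  unfolding bar_def using assms by (intro the_equality) auto

end

(* The triality relations force the three values at a point to commute: expanding g (bar g) once
   by the rule for left and once by the rule for right factors gives T S P = E next to S T P = E.
   Hence P at bar g is the inverse of P g, the relations take a form without bars,
   and each loop law is checked on S and T alone, which separate points. *)
theory Submission
  imports Defs
begin

locale triality_triple = groupoid G mul + group \<TT>
  for G :: "'a set" and mul :: "'a \<Rightarrow> 'a \<Rightarrow> 'a" (infixl "\<cdot>" 70)
    and \<TT> :: "('b, 'c) monoid_scheme" (structure) +
  fixes S T P :: "'a \<Rightarrow> 'b"
  assumes S_closed [simp]: "g \<in> G \<Longrightarrow> S g \<in> carrier \<TT>"
    and T_closed [simp]: "g \<in> G \<Longrightarrow> T g \<in> carrier \<TT>"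
    and P_closed [simp]: "g \<in> G \<Longrightarrow> P g \<in> carrier \<TT>"
    and STP: "g \<in> G \<Longrightarrow> S g \<otimes> T g \<otimes> P g = \<one>"
    and bar_exists: "g \<in> G \<Longrightarrow> \<exists>x\<in>G. S x = inv (S g) \<and> T x = inv (T g)"
    and S_bar_mult: "\<lbrakk>g \<in> G; h \<in> G\<rbrakk> \<Longrightarrow> S (bar G \<TT> S T g \<cdot> h) = P g \<otimes> S h \<otimes> T g"
    and T_bar_mult: "\<lbrakk>g \<in> G; h \<in> G\<rbrakk> \<Longrightarrow> T (bar G \<TT> S T g \<cdot> h) = S g \<otimes> T h \<otimes> P g"
    and P_bar_mult: "\<lbrakk>g \<in> G; h \<in> G\<rbrakk> \<Longrightarrow> P (bar G \<TT> S T g \<cdot> h) = T g \<otimes> P h \<otimes> S g"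
    and S_mult_bar: "\<lbrakk>g \<in> G; h \<in> G\<rbrakk> \<Longrightarrow> S (h \<cdot> bar G \<TT> S T g) = T g \<otimes> S h \<otimes> P g"
    and T_mult_bar: "\<lbrakk>g \<in> G; h \<in> G\<rbrakk> \<Longrightarrow> T (h \<cdot> bar G \<TT> S T g) = P g \<otimes> T h \<otimes> S g"
    and separating: "\<lbrakk>g \<in> G; h \<in> G; S g = S h; T g = T h\<rbrakk> \<Longrightarrow> g = h"
begin

abbreviation bar_elem :: "'a \<Rightarrow> 'a" where
  "bar_elem \<equiv> bar G \<TT> S T"

declare closed [simp]

text \<open>Once products are bracketed to the right, a factor and its inverse no longer form a
  subterm of their own when more factors follow. These rules cancel such a pair in front of the tail
  \<open>y\<close>.\<close>

lemma cancel_left: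
  "\<lbrakk>x \<in> carrier \<TT>; y \<in> carrier \<TT>\<rbrakk> \<Longrightarrow> x \<otimes> (inv x \<otimes> y) = y"
  "\<lbrakk>x \<in> carrier \<TT>; y \<in> carrier \<TT>\<rbrakk> \<Longrightarrow> inv x \<otimes> (x \<otimes> y) = y"
  by (simp_all flip: m_assoc)

lemmas group_normalize = m_assoc inv_mult_group cancel_left

text \<open>Existence is the hypothesis on inverse values and uniqueness is separation of points, so
  the definite description behind \<open>bar\<close> is meaningful.\<close>

lemma bar_props:
  assumes "g \<in> G"
  shows bar_closed [simp]: "bar_elem g \<in> G"
    and S_bar: "S (bar_elem g) = inv (S g)"
    and T_bar: "T (bar_elem g) = inv (T g)"
proof -
  obtain x where "x \<in> G" "S x = inv (S g)" "T x = inv (T g)"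
    using bar_exists assms by blast
  moreover from this have "bar_elem g = x"
    by (intro bar_unique separating)
  ultimately show "bar_elem g \<in> G" "S (bar_elem g) = inv (S g)" "T (bar_elem g) = inv (T g)"
    by simp_all
qed

text \<open>Inverting twice restores \<open>S g\<close> and \<open>T g\<close>. So every element is
  itself a bar, and the triality relations can be read for arbitrary factors.\<close>

lemma bar_bar:
  assumes "g \<in> G"
  shows "bar_elem (bar_elem g) = g"
  using assms by (intro separating) (simp_all add: S_bar T_bar)

lemma P_eq:
  assumes "g \<in> G"
  shows "P g = inv (T g) \<otimes> inv (S g)"
  using assms STP[OF assms] by (metis S_closed T_closed P_closed m_closed inv_equality inv_mult_group
      inv_inv inv_closed)

text \<open>Write g as the bar of \<open>bar_elem g\<close> and use the rules for left factors: the
  two values are P S T and S T P at \<open>bar_elem g\<close>. The second is trivial by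
  \<open>STP\<close>, the first as a cyclic rotation of it.\<close>

lemma mult_bar_values:
  assumes "g \<in> G"
  shows "S (g \<cdot> bar_elem g) = \<one>" "T (g \<cdot> bar_elem g) = \<one>"
  using S_bar_mult[of "bar_elem g" "bar_elem g"] T_bar_mult[of "bar_elem g" "bar_elem g"] assms
  by (simp_all add: bar_bar S_bar T_bar P_eq group_normalize)

lemma S_T_commute:
  assumes "g \<in> G"
  shows "S g \<otimes> T g = T g \<otimes> S g"
proof -
  \<comment> \<open>The rule for right factors expands the same trivial value
    \<open>S (g \<cdot> bar_elem g)\<close> with S and T in the opposite order; \<open>P g\<close>
    then cancels against \<open>STP\<close>.\<close>
  have "T g \<otimes> S g \<otimes> P g = \<one>"
    using S_mult_bar[OF assms assms] mult_bar_values[OF assms] by simp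
  then show ?thesis
    using STP[OF assms] assms by (metis S_closed T_closed P_closed m_closed right_cancel)
qed

text \<open>By \<open>P_eq\<close> the left side is T S and the right side is S T at g, so this is
  exactly where commutation enters.\<close>

lemma P_bar:
  assumes "g \<in> G"
  shows "P (bar_elem g) = inv (P g)"
  using assms by (simp add: P_eq S_bar T_bar inv_mult_group S_T_commute)

text \<open>These are the triality relations at the bar of a factor. The unprimed rules wrap values
  of the left factor around the right one, the primed rules do the reverse; the Moufang identity
  needs both.\<close>

lemma mult_expand:
  assumes "g \<in> G" "h \<in> G"
  shows S_mult: "S (g \<cdot> h) = inv (P g) \<otimes> S h \<otimes> inv (T g)"
    and T_mult: "T (g \<cdot> h) = inv (S g) \<otimes> T h \<otimes> inv (P g)"
    and P_mult: "P (g \<cdot> h) = inv (T g) \<otimes> P h \<otimes> inv (S g)"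
    and S_mult': "S (g \<cdot> h) = inv (T h) \<otimes> S g \<otimes> inv (P h)"
    and T_mult': "T (g \<cdot> h) = inv (P h) \<otimes> T g \<otimes> inv (S h)"
  using assms S_bar_mult[of "bar_elem g" h] T_bar_mult[of "bar_elem g" h]
    P_bar_mult[of "bar_elem g" h] S_mult_bar[of "bar_elem h" g] T_mult_bar[of "bar_elem h" g]
  by (simp_all add: bar_bar S_bar T_bar P_bar)

text \<open>The values of g and of \<open>bar_elem g\<close> that surround those of h are mutually
  inverse, so they cancel on each side.\<close>

lemma bar_cancel:
  assumes "g \<in> G" "h \<in> G"
  shows "g \<cdot> (bar_elem g \<cdot> h) = h" "bar_elem g \<cdot> (g \<cdot> h) = h"
    and "(h \<cdot> bar_elem g) \<cdot> g = h" "(h \<cdot> g) \<cdot> bar_elem g = h"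
proof -
  show "g \<cdot> (bar_elem g \<cdot> h) = h" "bar_elem g \<cdot> (g \<cdot> h) = h"
    using assms by (auto intro!: separating simp: S_mult T_mult S_bar T_bar P_bar group_normalize)
  show "(h \<cdot> bar_elem g) \<cdot> g = h" "(h \<cdot> g) \<cdot> bar_elem g = h"
    using assms by (auto intro!: separating simp: S_mult' T_mult' S_bar T_bar P_bar group_normalize)
qed

lemma unit_elementI:
  assumes "e \<in> G" "S e = \<one>" "T e = \<one>"
  shows "unit_element G (\<cdot>) e"
proof -
  have "P e = \<one>"
    using assms by (simp add: P_eq)
  have "e \<cdot> g = g" "g \<cdot> e = g" if "g \<in> G" for g
    using that assms \<open>P e = \<one>\<close>
    by (auto intro!: separating simp: S_mult[of e] T_mult[of e] S_mult'[of _ e] T_mult'[of _ e])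
  then show ?thesis
    using assms by (simp add: unit_element_def)
qed

lemma unit_element_mult_bar:
  assumes "g \<in> G"
  shows "unit_element G (\<cdot>) (g \<cdot> bar_elem g)"
  using assms by (intro unit_elementI) (simp_all add: mult_bar_values)

lemma unit_element_unique:
  assumes "unit_element G (\<cdot>) e" "unit_element G (\<cdot>) e'"
  shows "e = e'"
  using assms unfolding unit_element_def by metis

lemma moufang_identity:
  assumes "g \<in> G" "h \<in> G" "k \<in> G"
  shows "(g \<cdot> h) \<cdot> (k \<cdot> g) = (g \<cdot> (h \<cdot> k)) \<cdot> g"
proof (rule separating)
  \<comment> \<open>The three values at g commute and multiply to the identity, so each is the
    product of the inverses of the other two in either order.\<close>
  have PS: "inv (P g) \<otimes> inv (S g) = T g"
    using assms by (simp add: P_eq S_T_commute group_normalize)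
  have TP: "inv (T g) \<otimes> inv (P g) = S g"
    using assms by (simp add: P_eq S_T_commute[symmetric] inv_mult_group)
      (simp add: S_T_commute group_normalize)
  \<comment> \<open>Wrapping \<open>g \<cdot> h\<close> around \<open>k \<cdot> g\<close>, with the
    latter expanded by its right factor, makes the inner T and P values of g cancel. What remains
    between the outer \<open>S g\<close> is \<open>S (h \<cdot> k)\<close>.\<close>
  have "S ((g \<cdot> h) \<cdot> (k \<cdot> g)) = S g \<otimes> S (h \<cdot> k) \<otimes> S g"
    using assms by (simp add: S_mult[of "g \<cdot> h"] S_mult[of h] S_mult'[of k] P_mult T_mult
        group_normalize)
  \<comment> \<open>After this splitting the two inner factors express multiplication by g on the
    left, and the two outer ones multiplication by g on the right.\<close>
  also have "\<dots> = (inv (T g) \<otimes> inv (P g)) \<otimes> S (h \<cdot> k) \<otimes> (inv (T g) \<otimes> inv (P g))"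
    by (simp only: TP)
  also have "\<dots> = inv (T g) \<otimes> ((inv (P g)) \<otimes> S (h \<cdot> k) \<otimes> inv (T g)) \<otimes> inv (P g)"
    using assms by (simp add: m_assoc)
  also have "\<dots> = S ((g \<cdot> (h \<cdot> k)) \<cdot> g)"
    using assms by (simp add: S_mult'[of "g \<cdot> (h \<cdot> k)"] S_mult[of g])
  finally show "S ((g \<cdot> h) \<cdot> (k \<cdot> g)) = S ((g \<cdot> (h \<cdot> k)) \<cdot> g)" .
  have "T ((g \<cdot> h) \<cdot> (k \<cdot> g)) = T g \<otimes> T (h \<cdot> k) \<otimes> T g"
    using assms by (simp add: T_mult[of "g \<cdot> h"] T_mult[of h] T_mult'[of k] P_mult S_mult
        group_normalize)
  also have "\<dots> = (inv (P g) \<otimes> inv (S g)) \<otimes> T (h \<cdot> k) \<otimes> (inv (P g) \<otimes> inv (S g))"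
    by (simp only: PS)
  also have "\<dots> = inv (P g) \<otimes> ((inv (S g)) \<otimes> T (h \<cdot> k) \<otimes> inv (P g)) \<otimes> inv (S g)"
    using assms by (simp add: m_assoc)
  also have "\<dots> = T ((g \<cdot> (h \<cdot> k)) \<cdot> g)"
    using assms by (simp add: T_mult'[of "g \<cdot> (h \<cdot> k)"] T_mult[of g])
  finally show "T ((g \<cdot> h) \<cdot> (k \<cdot> g)) = T ((g \<cdot> (h \<cdot> k)) \<cdot> g)" .
qed (use assms in simp_all)

lemma moufang_loopI:
  assumes "G \<noteq> {}"
  shows "moufang_loop G (\<cdot>)"
proof
  show "\<exists>!h. h \<in> G \<and> g \<cdot> h = k" if "g \<in> G" "k \<in> G" for g k
    \<comment> \<open>One cancellation law shows that the witness solves the equation, its companion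
      that every solution equals it.\<close>
    using that bar_cancel by (intro ex1I[of _ "bar_elem g \<cdot> k"]) auto
  show "\<exists>!g. g \<in> G \<and> g \<cdot> h = k" if "h \<in> G" "k \<in> G" for h k
    using that bar_cancel by (intro ex1I[of _ "k \<cdot> bar_elem h"]) auto
  show "\<exists>e. unit_element G (\<cdot>) e"
    using assms unit_element_mult_bar by blast
qed (simp add: moufang_identity)

text \<open>A unit is unique, so all products \<open>g \<cdot> bar_elem g\<close> coincide with it;
  the reversed product is the same statement at \<open>bar_elem g\<close>.\<close>

lemma mult_bar_unit:
  assumes "unit_element G (\<cdot>) e" "g \<in> G"
  shows "g \<cdot> bar_elem g = e" "bar_elem g \<cdot> g = e"
  using unit_element_unique[OF unit_element_mult_bar assms(1)] assms(2)
  by (metis bar_bar bar_closed)+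

lemma inverse_element_iff:
  assumes "unit_element G (\<cdot>) e" "g \<in> G"
  shows "inverse_element G (\<cdot>) e g x \<longleftrightarrow> x = bar_elem g"
proof
  assume "inverse_element G (\<cdot>) e g x"
  then have "x \<in> G" "g \<cdot> x = g \<cdot> bar_elem g"
    using mult_bar_unit[OF assms] by (simp_all add: inverse_element_def)
  \<comment> \<open>Multiplying both products by \<open>bar_elem g\<close> on the left cancels
    g.\<close>
  then show "x = bar_elem g"
    using assms(2) bar_cancel(2) by (metis bar_closed)
qed (use assms mult_bar_unit in \<open>simp add: inverse_element_def\<close>)

end

theorem theorem3p1:
  fixes G :: "'a set"
    and mul :: "'a \<Rightarrow> 'a \<Rightarrow> 'a" (infixl "\<cdot>" 70)
    and \<TT> :: "('b, 'c) monoid_scheme" (structure)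
    and S T P :: "'a \<Rightarrow> 'b"
  assumes "groupoid G (\<cdot>)" and "G \<noteq> {}" and "group \<TT>"
    and "S \<in> G \<rightarrow> carrier \<TT>" and "T \<in> G \<rightarrow> carrier \<TT>" and "P \<in> G \<rightarrow> carrier \<TT>"
    and "\<forall>g\<in>G. S g \<otimes> T g \<otimes> P g = \<one>"
    and "\<forall>g\<in>G. \<exists>x\<in>G. S x = inv (S g) \<and> T x = inv (T g)"
    and "\<forall>g\<in>G. \<forall>h\<in>G.
           S (bar G \<TT> S T g \<cdot> h) = P g \<otimes> S h \<otimes> T g \<and>
           T (bar G \<TT> S T g \<cdot> h) = S g \<otimes> T h \<otimes> P g \<and>
           P (bar G \<TT> S T g \<cdot> h) = T g \<otimes> P h \<otimes> S g \<and>
           S (h \<cdot> bar G \<TT> S T g) = T g \<otimes> S h \<otimes> P g \<and>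
           T (h \<cdot> bar G \<TT> S T g) = P g \<otimes> T h \<otimes> S g \<and>
           P (h \<cdot> bar G \<TT> S T g) = S g \<otimes> P h \<otimes> T g"
    and "\<forall>g\<in>G. \<forall>h\<in>G. S g = S h \<and> T g = T h \<longrightarrow> g = h"
  shows "moufang_loop G (\<cdot>) \<and>
         (\<exists>e. unit_element G (\<cdot>) e \<and>
              (\<forall>g\<in>G. e = g \<cdot> bar G \<TT> S T g \<and> e = bar G \<TT> S T g \<cdot> g) \<and>
              (\<forall>g\<in>G. \<forall>x. inverse_element G (\<cdot>) e g x \<longleftrightarrow> x = bar G \<TT> S T g))"
proof -
  interpret groupoid G "(\<cdot>)" by fact
  interpret group \<TT> by fact
  interpret triality_triple G "(\<cdot>)" \<TT> S T P
    by unfold_locales (use assms in auto)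
  obtain e where e: "unit_element G (\<cdot>) e"
    using \<open>G \<noteq> {}\<close> unit_element_mult_bar by blast
  then show ?thesis
    using moufang_loopI[OF \<open>G \<noteq> {}\<close>] mult_bar_unit[OF e] inverse_element_iff[OF e] by auto
qed

end
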